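(* Let $G$ be a finite simple graph with maximum degree at most $5$. Then $$ \mathrm{ind}(G) \leq 2^{\mathrm{iso}(G)}\prod_{uv \in E(G)} \left(2^{d(u)}+2^{d(v)}-1\right)^{\frac{1}{d(u)d(v)}}. $$ Moreover, equality holds if and only if each connected component of $G$ is either a complete bipartite graph or a single vertex.
   Context: $\mathrm{ind}(G)$ is the number of independent sets of $G$ (sets of vertices no two of which are adjacent, including the empty set). $d(u)$ is the degree of $u$, and $\mathrm{iso}(G)$ is the number of isolated vertices of $G$. Conventions: the graph with no vertices has exactly $1$ independent set, and an empty product equals $1$. Note that $2^a+2^b-1=\mathrm{ind}(K_{a,b})$, where $K_{a,b}$ is the complete bipartite graph with parts of sizes $a$ and $b$. *)

theory Defs
  imports Complex_Main "Graph_Theory.Graph_Theory"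
begin

text \<open>
  Finite simple graphs are the \<^locale>\<open>graph\<close>s of \<open>Graph_Theory\<close>: finite,
  symmetric, loop-free digraphs without parallel arcs. An undirected edge is thus a pair of
  opposite arcs, and the out-degree of a vertex is the number of its neighbours, i.e. its degree.
\<close>

abbreviation degree :: "('a, 'b) pre_digraph \<Rightarrow> 'a \<Rightarrow> nat" where
  "degree G v \<equiv> out_degree G v"

definition edges :: "('a, 'b) pre_digraph \<Rightarrow> 'a set set" where
  "edges G = {{u, v} | u v. u \<rightarrow>\<^bsub>G\<^esub> v}"

definition indep_set :: "('a, 'b) pre_digraph \<Rightarrow> 'a set \<Rightarrow> bool" where
  "indep_set G S \<longleftrightarrow> S \<subseteq> verts G \<and> (\<forall>u\<in>S. \<forall>v\<in>S. u \<noteq> v \<longrightarrow> \<not> u \<rightarrow>\<^bsub>G\<^esub> v)"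

definition ind :: "('a, 'b) pre_digraph \<Rightarrow> nat" where
  "ind G = card {S. indep_set G S}"

definition num_iso :: "('a, 'b) pre_digraph \<Rightarrow> nat" where
  "num_iso G = card {v \<in> verts G. degree G v = 0}"

text \<open>
  The factor contributed by an edge is symmetric in its two ends, so it is written with a sum
  and a product over the two-element set; see \<open>edge_factor_doubleton\<close> for the explicit form.
\<close>

definition edge_factor :: "('a, 'b) pre_digraph \<Rightarrow> 'a set \<Rightarrow> real" where
  "edge_factor G e =
     ((\<Sum>w\<in>e. 2 ^ degree G w) - 1) powr (1 / (\<Prod>w\<in>e. real (degree G w)))"

lemma edge_factor_doubleton:
  assumes "u \<noteq> v"
  shows "edge_factor G {u, v} =
    (2 ^ degree G u + 2 ^ degree G v - 1) powr (1 / (real (degree G u) * real (degree G v)))"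
  using assms by (simp add: edge_factor_def)

lemma (in graph) doubleton_in_edges_iff: "{u, v} \<in> edges G \<longleftrightarrow> u \<rightarrow>\<^bsub>G\<^esub> v"
  using sym_arcs unfolding edges_def symmetric_def
  by (auto simp: doubleton_eq_iff dest: symD)

lemma (in graph) degree_eq_card_neighbours: "degree G u = card {v. u \<rightarrow>\<^bsub>G\<^esub> v}"
proof -
  have "{v. u \<rightarrow>\<^bsub>G\<^esub> v} = head G ` out_arcs G u"
    by (auto simp: arcs_ends_def arc_to_ends_def image_iff)
  moreover have "inj_on (head G) (out_arcs G u)"
    by (auto simp: inj_on_def arc_to_ends_def intro: no_multi_arcs)
  ultimately show ?thesis by (simp add: out_degree_def card_image)
qed

definition complete_bipartite :: "('a, 'b) pre_digraph \<Rightarrow> bool" where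
  "complete_bipartite H \<longleftrightarrow>
     (\<exists>a b. a \<ge> 1 \<and> b \<ge> 1 \<and> complete_bipartite_digraph a b H)"

text \<open>
  In a symmetric digraph reachability is symmetric, hence strongly connected components
  (\<open>pre_digraph.sccs\<close>, the maximal strongly connected induced subgraphs) are the connected
  components.
\<close>

abbreviation components :: "('a, 'b) pre_digraph \<Rightarrow> ('a, 'b) pre_digraph set" where
  "components G \<equiv> pre_digraph.sccs G"

end

theory Submission
  imports Defs
begin

text \<open>
  Let \<open>ef a b = ln (2^a + 2^b - 1) / (a b)\<close>, so that the logarithm of the bound is
  \<open>pot = iso \<cdot> ln 2 + \<Sum> ef (d u) (d v)\<close>, the sum running over the edges.

  Suppose first that \<open>G\<close> has no closed walk of length 5, for instance that \<open>G\<close> is bipartite. Let \<open>w\<close>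
  have maximal degree \<open>d\<close>, let \<open>N\<close> be its neighbourhood and \<open>W\<close> the set of vertices at distance 2;
  \<open>N\<close> and \<open>W\<close> are independent. By induction and \<open>ind G = ind (G - w) + ind (G - w - N)\<close> it
  suffices that \<open>exp (pot (G - w) - pot G) + exp (pot (G - w - N) - pot G) \<le> 1\<close>. The first
  exponent is a sum over \<open>v \<in> N\<close> and \<open>u \<in> W\<close> adjacent to \<open>v\<close>; by a convexity estimate the second one
  is at most a sum of the same shape, with equality iff no vertex of \<open>W\<close> has a neighbour outside \<open>N\<close>.
  Jensen's inequality then reduces the claim to an inequality in the three degrees of \<open>w\<close>, \<open>v\<close>, \<open>u\<close>,
  which is an identity if \<open>u\<close> has degree \<open>d\<close> and a finite check of strict inequalities otherwise.
  Hence equality forces every vertex of \<open>W\<close> to have neighbourhood \<open>N\<close>, so that the component of \<open>w\<close>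
  is complete bipartite. Inductively, equality holds iff \<open>x \<sim> y \<sim> z \<sim> t\<close> always implies
  \<open>x \<sim> t\<close>, and this condition itself excludes closed walks of length 5.

  A general graph \<open>G\<close> is compared with its bipartite double cover \<open>G \<times> K\<^sub>2\<close>, for which \<open>pot\<close> doubles and
  \<open>(ind G)\<^sup>2 \<le> ind (G \<times> K\<^sub>2)\<close>.
\<close>

section \<open>Inequalities between edge factors\<close>

definition ef :: "nat \<Rightarrow> nat \<Rightarrow> real" where
  "ef a b = ln (2 ^ a + 2 ^ b - 1) / (real a * real b)"

lemma ef_commute: "ef a b = ef b a"
  by (simp add: ef_def algebra_simps)

lemma ef_base_pos: "0 < (2 ^ a + 2 ^ b - 1 :: real)"
  by (smt (verit) one_le_power zero_less_power)

text \<open>The sequence \<open>ln (1 - t + t * 2 ^ k)\<close> vanishes at \<open>k = 0\<close> and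
  is strictly convex in \<open>k\<close>, so its quotient by \<open>k\<close> strictly
  increases.\<close>

lemma ln_mixture_ratio_less_Suc:
  fixes t :: real
  assumes "0 < t" "t < 1" "k \<ge> 1"
  shows "real (Suc k) * ln (1 - t + t * 2 ^ k) < real k * ln (1 - t + t * 2 ^ Suc k)"
  using assms(3)
proof (induction k rule: dec_induct)
  let ?a = "\<lambda>k::nat. 1 - t + t * 2 ^ k"
  have pos: "?a k > 0" for k using assms by (simp add: add_pos_pos)
  have conv: "2 * ln (?a (Suc k)) < ln (?a k) + ln (?a (Suc (Suc k)))" for k
  proof -
    have "?a k * ?a (Suc (Suc k)) - (?a (Suc k))\<^sup>2 = t * (1 - t) * 2 ^ k"
      by (simp add: power2_eq_square algebra_simps)
    moreover have "t * (1 - t) * 2 ^ k > 0" using assms by simp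
    ultimately have "(?a (Suc k))\<^sup>2 < ?a k * ?a (Suc (Suc k))" by linarith
    then have "ln ((?a (Suc k))\<^sup>2) < ln (?a k * ?a (Suc (Suc k)))"
      using pos by (intro ln_less_cancel_iff[THEN iffD2] mult_pos_pos zero_less_power)
    then show ?thesis using pos[of k] pos[of "Suc k"] pos[of "Suc (Suc k)"]
      by (simp add: ln_mult ln_realpow del: power_Suc)
  qed
  {
    case base
    show ?case using conv[of 0] by simp
  next
    case (step k)
    have "real (Suc k) * (2 * ln (?a (Suc k))) < real (Suc k) * (ln (?a k) + ln (?a (Suc (Suc k))))"
      using conv by (intro mult_strict_left_mono) auto
    with step.IH show ?case by (simp add: algebra_simps)
  }
qed

text \<open>
  Up to the factor \<open>1/e\<close>, the numbers \<open>ef k e - ln 2 / k\<close> are the chord slopes \<open>L k / k\<close> of the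
  convex function \<open>L k = ln (1 + (2^k - 1) / 2^e)\<close>, which vanishes at \<open>0\<close>.
\<close>

lemma ef_diff_less_Suc:
  assumes "1 \<le> k" "1 \<le> e"
  shows "ef k e - ln 2 / real k < ef (Suc k) e - ln 2 / real (Suc k)"
proof -
  define L where "L n = ln (1 - 1 / 2 ^ e + 1 / 2 ^ e * 2 ^ n :: real)" for n :: nat
  have one: "(1::real) < 2 ^ e" using assms by (simp add: one_less_power)
  have ln_eq: "ln (2 ^ n + 2 ^ e - 1 :: real) = real e * ln 2 + L n" for n
  proof -
    have "(2 ^ n + 2 ^ e - 1 :: real) = 2 ^ e * (1 - 1 / 2 ^ e + 1 / 2 ^ e * 2 ^ n)"
      by (simp add: field_simps)
    moreover have "(1 - 1 / 2 ^ e + 1 / 2 ^ e * 2 ^ n :: real) > 0"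
      using one by (simp add: add_pos_pos)
    ultimately show ?thesis unfolding L_def
      by (simp only: ln_mult_pos ln_realpow zero_less_power zero_less_numeral)
  qed
  have ef_eq: "ef n e - ln 2 / real n = L n / real n / real e" if "n \<ge> 1" for n
    using that assms by (simp add: ef_def ln_eq divide_simps)
  have "real (Suc k) * L k < real k * L (Suc k)"
    unfolding L_def using ln_mixture_ratio_less_Suc[of "1 / 2 ^ e" k] one assms by simp
  then have "L k / real k < L (Suc k) / real (Suc k)"
    using assms by (simp add: field_simps)
  then have "L k / real k / real e < L (Suc k) / real (Suc k) / real e"
    using assms by (intro divide_strict_right_mono) auto
  then show ?thesis using assms by (simp only: ef_eq le_SucI)
qed

text \<open>Telescoped form of \<open>ef_diff_less_Suc\<close>, for an edge with one end whose
  degree falls from \<open>D\<close> to \<open>k\<close>.\<close>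

lemma ef_diff_less:
  assumes "1 \<le> k" "k < D" "1 \<le> e"
  shows "ef k e - ef D e < ln 2 / real k - ln 2 / real D"
proof -
  have "ef k e - ln 2 / real k < ef D e - ln 2 / real D"
    using Suc_leI[OF assms(2)]
  proof (induction D rule: dec_induct)
    case base
    show ?case using ef_diff_less_Suc assms by blast
  next
    case (step D)
    then show ?case using ef_diff_less_Suc[of D e] assms by linarith
  qed
  then show ?thesis by linarith
qed

section \<open>The inequality in three degrees\<close>

text \<open>
  \<open>vloss d c D\<close> and \<open>nloss d c D\<close> are the shares of a pair \<open>v\<close>, \<open>u\<close> with \<open>v\<close> adjacent to \<open>w\<close> and \<open>u\<close> to
  \<open>v\<close>, of degrees \<open>d\<close>, \<open>c\<close>, \<open>D\<close> for \<open>w\<close>, \<open>v\<close>, \<open>u\<close>, in the decrease of the logarithm of the bound when \<open>w\<close>,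
  respectively \<open>w\<close> together with its neighbours, is deleted. The normalisation makes the total
  decrease a mean of shares over \<open>v\<close> and \<open>u\<close>.
\<close>

definition vloss :: "nat \<Rightarrow> nat \<Rightarrow> nat \<Rightarrow> real" where
  "vloss d c D = real d * ef d c + real d * real (c - 1) * (ef c D - ef (c - 1) D)"

definition nloss :: "nat \<Rightarrow> nat \<Rightarrow> nat \<Rightarrow> real" where
  "nloss d c D = real d * ef d c + real d * real (c - 1) * (ef c D - ln 2 / real D)"

text \<open>Over the common denominator \<open>exp Z\<close> only powers with exponent
  \<open>d / D\<close> remain in the numerators, so bounding the sum by 1 becomes a comparison of
  algebraic numbers.\<close>

lemma exp_losses_eq:
  assumes "2 \<le> c" "1 \<le> D" "1 \<le> d"
  defines "Z \<equiv> ln (2 ^ d + 2 ^ c - 1) / real c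
      + real d * real (c - 1) / (real c * real D) * ln (2 ^ c + 2 ^ D - 1)"
  shows "exp (- vloss d c D) = exp (real d / real D * ln (2 ^ (c - 1) + 2 ^ D - 1)) / exp Z"
    and "exp (- nloss d c D) = exp (real d / real D * ln (2 ^ (c - 1))) / exp Z"
proof -
  have "- vloss d c D = real d / real D * ln (2 ^ (c - 1) + 2 ^ D - 1) - Z"
    using assms unfolding vloss_def ef_def Z_def by (simp add: divide_simps) (simp add: algebra_simps)
  then show "exp (- vloss d c D) = exp (real d / real D * ln (2 ^ (c - 1) + 2 ^ D - 1)) / exp Z"
    by (simp add: exp_diff)
  have "- nloss d c D = real d / real D * ln (2 ^ (c - 1)) - Z"
    using assms unfolding nloss_def ef_def Z_def
    by (simp add: divide_simps ln_realpow) (simp add: algebra_simps)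
  then show "exp (- nloss d c D) = exp (real d / real D * ln (2 ^ (c - 1))) / exp Z"
    by (simp add: exp_diff)
qed

text \<open>For \<open>D = d\<close> the exponent \<open>d / D\<close> is 1, and the numerators add
  up to \<open>exp Z = 2 ^ c + 2 ^ d - 1\<close>. Complete bipartite graphs realise this
  case.\<close>

lemma exp_losses_diag:
  assumes "2 \<le> c" "1 \<le> d"
  shows "exp (- vloss d c d) + exp (- nloss d c d) = 1"
proof -
  have *: "(2::real) ^ c = 2 * 2 ^ (c - 1)"
    using assms by (metis One_nat_def Suc_pred less_le_trans pos2 power_Suc)
  have Z: "ln (2 ^ d + 2 ^ c - 1) / real c
      + real d * real (c - 1) / (real c * real d) * ln (2 ^ c + 2 ^ d - 1) = ln (2 ^ c + 2 ^ d - 1)"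
    using assms by (simp add: field_simps of_nat_diff)
  show ?thesis
    unfolding exp_losses_eq[OF assms(1) assms(2) assms(2)] Z
    using assms ef_base_pos[of "c - 1" d] ef_base_pos[of c d]
    by (simp add: add_divide_distrib[symmetric] * del: ln_realpow)
qed

text \<open>Upper bounds \<open>q\<close> and \<open>r\<close> for the two numerators remove the
  exponent \<open>d / D\<close>, and the power \<open>c * D\<close> clears the fractions in
  \<open>Z\<close>. For rational \<open>q\<close> and \<open>r\<close> the hypotheses are plain
  arithmetic.\<close>

lemma exp_losses_less_one:
  fixes q r :: real
  assumes "2 \<le> c" "1 \<le> D" "1 \<le> d" and "0 < q" "0 < r"
    and q: "(2 ^ (c - 1) + 2 ^ D - 1) ^ d \<le> q ^ D"
    and r: "(2 ^ (c - 1)) ^ d \<le> r ^ D"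
    and qr: "(q + r) ^ (c * D) < (2 ^ d + 2 ^ c - 1) ^ D * (2 ^ c + 2 ^ D - 1) ^ (d * (c - 1))"
  shows "exp (- vloss d c D) + exp (- nloss d c D) < 1"
proof -
  let ?Z = "ln (2 ^ d + 2 ^ c - 1) / real c
      + real d * real (c - 1) / (real c * real D) * ln (2 ^ c + 2 ^ D - 1 :: real)"
  have root: "exp (real d / real D * ln x) \<le> y" if "0 < x" "0 < y" "x ^ d \<le> y ^ D" for x y :: real
  proof -
    have "real d * ln x \<le> real D * ln y"
      using that by (simp flip: ln_realpow)
    then have "real d / real D * ln x \<le> ln y" using assms by (simp add: field_simps)
    then show ?thesis using that by (metis exp_le_cancel_iff exp_ln)
  qed
  have "ln ((q + r) ^ (c * D)) < ln ((2 ^ d + 2 ^ c - 1) ^ D * (2 ^ c + 2 ^ D - 1) ^ (d * (c - 1)) :: real)"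
    using qr assms ef_base_pos[of d c] ef_base_pos[of c D]
    by (subst ln_less_cancel_iff) auto
  then have "real (c * D) * ln (q + r)
      < real D * ln (2 ^ d + 2 ^ c - 1) + real (d * (c - 1)) * ln (2 ^ c + 2 ^ D - 1)"
    using assms ef_base_pos[of d c] ef_base_pos[of c D]
    by (simp add: ln_mult_pos ln_realpow del: of_nat_mult)
  then have "ln (q + r) < ?Z"
    using assms by (simp add: field_simps)
  then have "q + r < exp ?Z"
    using assms by (metis add_pos_pos exp_less_cancel_iff exp_ln)
  moreover have "exp (real d / real D * ln (2 ^ (c - 1) + 2 ^ D - 1)) \<le> q"
    using q assms ef_base_pos by (intro root) auto
  moreover have "exp (real d / real D * ln (2 ^ (c - 1))) \<le> r"
    using r assms by (intro root) auto
  ultimately show ?thesis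
    unfolding exp_losses_eq[OF assms(1-3)] by (simp add: divide_simps flip: add_divide_distrib)
qed


text \<open>
  The witnesses \<open>q\<close> and \<open>r\<close> are upper roundings, to multiples of \<open>1/4\<close> or coarser, of
  \<open>(2^(c-1) + 2^D - 1)^(d/D)\<close> and \<open>(2^(c-1))^(d/D)\<close>.
\<close>

lemma exp_losses_less_one_upto_5:
  assumes "2 \<le> c" "c \<le> d" "1 \<le> D" "D < d" "d \<le> 5"
  shows "exp (- vloss d c D) + exp (- nloss d c D) < 1"
proof -
  define T :: "(nat \<times> nat \<times> nat \<times> real \<times> real) set" where "T = {
      (2, 2, 1, 9, 4), (3, 2, 1, 27, 8), (3, 2, 2, 45/4, 3), (3, 3, 1, 125, 64),
      (3, 3, 2, 19, 8), (4, 2, 1, 81, 16), (4, 2, 2, 25, 4), (4, 2, 3, 75/4, 11/4),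
      (4, 3, 1, 625, 256), (4, 3, 2, 49, 16), (4, 3, 3, 49/2, 13/2), (4, 4, 1, 6561, 4096),
      (4, 4, 2, 121, 64), (4, 4, 3, 37, 16), (5, 2, 1, 243, 32), (5, 2, 2, 56, 6),
      (5, 2, 3, 39, 4), (5, 2, 4, 139/4, 5/2), (5, 3, 1, 3125, 1024), (5, 3, 2, 130, 32),
      (5, 3, 3, 55, 11), (5, 3, 4, 40, 6), (5, 4, 1, 59049, 32768), (5, 4, 2, 402, 182),
      (5, 4, 3, 92, 32), (5, 4, 4, 51, 14), (5, 5, 1, 1419857, 1048576), (5, 5, 2, 1574, 1024),
      (5, 5, 3, 187, 102), (5, 5, 4, 74, 32)}"
  have check: "\<forall>(d, c, D, q, r) \<in> T. 0 < q \<and> 0 < r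
      \<and> (2 ^ (c - 1) + 2 ^ D - 1) ^ d \<le> q ^ D \<and> (2 ^ (c - 1)) ^ d \<le> r ^ D
      \<and> (q + r) ^ (c * D) < (2 ^ d + 2 ^ c - 1) ^ D * (2 ^ c + 2 ^ D - 1) ^ (d * (c - 1))"
    unfolding T_def by (simp add: power_divide)
  have "c = 2 \<or> c = 3 \<or> c = 4 \<or> c = 5" "d = 2 \<or> d = 3 \<or> d = 4 \<or> d = 5"
    "D = 1 \<or> D = 2 \<or> D = 3 \<or> D = 4" using assms by linarith+
  then have "(d, c, D) \<in> (\<lambda>(d, c, D, q, r). (d, c, D)) ` T"
    using assms unfolding T_def by (elim disjE) simp_all
  then obtain q r where qr: "(d, c, D, q, r) \<in> T" by auto
  show ?thesis
    using bspec[OF check qr] assms by (intro exp_losses_less_one[of c D d q r]) auto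
qed

section \<open>Jensen's inequality and averaging over a star\<close>

lemma exp_average_le:
  fixes x :: "'i \<Rightarrow> real"
  assumes "finite A" "A \<noteq> {}"
  shows "exp ((\<Sum>i\<in>A. x i) / real (card A)) \<le> (\<Sum>i\<in>A. exp (x i)) / real (card A)"
proof -
  define m where "m = (\<Sum>i\<in>A. x i) / real (card A)"
  have card: "real (card A) > 0" using assms by (simp add: card_gt_0_iff)
  \<comment> \<open>The tangent line to \<open>exp\<close> at the mean \<open>m\<close> lies below
    the curve; summed over \<open>A\<close>, its linear terms cancel.\<close>
  have "exp m * (1 + (x i - m)) \<le> exp (x i)" for i
    using mult_left_mono[OF exp_ge_add_one_self[of "x i - m"], of "exp m"]
    by (simp flip: exp_add)
  then have "(\<Sum>i\<in>A. exp m * (1 + (x i - m))) \<le> (\<Sum>i\<in>A. exp (x i))" by (intro sum_mono)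
  moreover have "(\<Sum>i\<in>A. exp m * (1 + (x i - m))) = exp m * real (card A)"
    using card by (simp add: m_def sum.distrib sum_subtractf flip: sum_distrib_left)
  ultimately show ?thesis using card by (simp add: m_def field_simps)
qed

text \<open>Jensen's inequality is applied to both families. In the equality case the defects
  \<open>1 - (exp (x i) + exp (y i))\<close> are nonnegative with sum at most 0, so all
  vanish.\<close>

lemma exp_averages_le_one:
  fixes x y :: "'i \<Rightarrow> real"
  assumes "finite A" "A \<noteq> {}"
    and le: "\<And>i. i \<in> A \<Longrightarrow> exp (x i) + exp (y i) \<le> 1"
  shows "exp ((\<Sum>i\<in>A. x i) / real (card A)) + exp ((\<Sum>i\<in>A. y i) / real (card A)) \<le> 1"
    and "exp ((\<Sum>i\<in>A. x i) / real (card A)) + exp ((\<Sum>i\<in>A. y i) / real (card A)) = 1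
      \<Longrightarrow> i \<in> A \<Longrightarrow> exp (x i) + exp (y i) = 1"
proof -
  have card: "real (card A) > 0" using assms by (simp add: card_gt_0_iff)
  have avg: "exp ((\<Sum>i\<in>A. x i) / real (card A)) + exp ((\<Sum>i\<in>A. y i) / real (card A))
      \<le> (\<Sum>i\<in>A. exp (x i) + exp (y i)) / real (card A)"
    using exp_average_le[OF assms(1,2), of x] exp_average_le[OF assms(1,2), of y]
    by (simp add: sum.distrib add_divide_distrib)
  also have "\<dots> \<le> 1"
    using sum_mono[of A "\<lambda>i. exp (x i) + exp (y i)" "\<lambda>_. 1"] le card by simp
  finally show "exp ((\<Sum>i\<in>A. x i) / real (card A)) + exp ((\<Sum>i\<in>A. y i) / real (card A)) \<le> 1" .
  assume "exp ((\<Sum>i\<in>A. x i) / real (card A)) + exp ((\<Sum>i\<in>A. y i) / real (card A)) = 1" and i: "i \<in> A"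
  with avg card have "real (card A) \<le> (\<Sum>i\<in>A. exp (x i) + exp (y i))" by (simp add: field_simps)
  then have "(\<Sum>i\<in>A. 1 - (exp (x i) + exp (y i))) \<le> 0" by (simp add: sum_subtractf)
  moreover have "(\<Sum>i\<in>A. 1 - (exp (x i) + exp (y i))) \<ge> 0" using le by (intro sum_nonneg) simp
  ultimately have "(\<Sum>i\<in>A. 1 - (exp (x i) + exp (y i))) = 0" by linarith
  then show "exp (x i) + exp (y i) = 1"
    using i le assms(1) by (subst (asm) sum_nonneg_eq_0_iff) auto
qed

text \<open>Here \<open>d\<close> is the degree of \<open>w\<close>, \<open>c\<close> that of a
  neighbour \<open>v\<close>, and \<open>A\<close> holds the other neighbours of \<open>v\<close>.
  For nonempty \<open>A\<close>, \<open>d * x\<close> and \<open>d * y\<close> are the means of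
  \<open>vloss\<close> and \<open>nloss\<close> over \<open>A\<close>, so the estimates for single
  pairs carry over.\<close>

lemma star_losses:
  fixes D :: "'i \<Rightarrow> nat" and c d :: nat
  assumes "finite A" "c = Suc (card A)" "c \<le> d" "d \<le> 5"
    and D: "\<And>u. u \<in> A \<Longrightarrow> 1 \<le> D u \<and> D u \<le> d"
  defines "x \<equiv> ef d c + (\<Sum>u\<in>A. ef c (D u) - ef (c - 1) (D u)) - (if c = 1 then ln 2 else 0)"
    and "y \<equiv> ef d c + (\<Sum>u\<in>A. ef c (D u) - ln 2 / real (D u))"
  shows "exp (- (real d * x)) + exp (- (real d * y)) \<le> 1"
    and "exp (- (real d * x)) + exp (- (real d * y)) = 1 \<longleftrightarrow> (\<forall>u\<in>A. D u = d)"
proof -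
  have "exp (- (real d * x)) + exp (- (real d * y)) \<le> 1
    \<and> (exp (- (real d * x)) + exp (- (real d * y)) = 1 \<longleftrightarrow> (\<forall>u\<in>A. D u = d))"
  proof (cases "A = {}")
    \<comment> \<open>A leaf \<open>v\<close> becomes isolated when \<open>w\<close> is deleted,
      whence the term \<open>ln 2\<close>; the two exponentials are
      \<open>2 ^ d / (2 ^ d + 1)\<close> and \<open>1 / (2 ^ d + 1)\<close>.\<close>
    case True
    then have c: "c = 1" using assms by simp
    have "real d * ef d c = ln (2 ^ d + 1)" using assms c by (simp add: ef_def add.commute)
    then have eq: "- (real d * x) = ln (2 ^ d) - ln (2 ^ d + 1)" "- (real d * y) = - ln (2 ^ d + 1)"
      using True c by (simp_all add: x_def y_def algebra_simps ln_realpow)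
    have pos: "(2 ^ d + 1 :: real) > 0" by (simp add: add_pos_pos)
    then have "exp (- (real d * x)) + exp (- (real d * y)) = 1"
      unfolding eq by (simp add: exp_diff exp_minus field_simps del: ln_realpow)
    then show ?thesis using True by simp
  next
    case False
    then have c2: "c \<ge> 2" and card: "real (c - 1) = real (card A)" "real (card A) > 0"
      using assms by (simp_all add: card_gt_0_iff Suc_le_eq)
    have "(\<Sum>u\<in>A. vloss d c (D u)) = real (card A) * (real d * x)"
      unfolding vloss_def x_def sum.distrib sum_distrib_left[symmetric] sum_constant card(1)
      using c2 by (simp add: distrib_left)
    then have x: "- (real d * x) = (\<Sum>u\<in>A. - vloss d c (D u)) / real (card A)"
      using card by (simp add: sum_negf)
    have "(\<Sum>u\<in>A. nloss d c (D u)) = real (card A) * (real d * y)"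
      unfolding nloss_def y_def sum.distrib sum_distrib_left[symmetric] sum_constant card(1)
      by (simp add: distrib_left)
    then have y: "- (real d * y) = (\<Sum>u\<in>A. - nloss d c (D u)) / real (card A)"
      using card by (simp add: sum_negf)
    have le: "exp (- vloss d c (D u)) + exp (- nloss d c (D u)) \<le> 1"
      and eq: "exp (- vloss d c (D u)) + exp (- nloss d c (D u)) = 1 \<longleftrightarrow> D u = d" if "u \<in> A" for u
      using exp_losses_diag[of c d] exp_losses_less_one_upto_5[of c d "D u"] D[OF that] c2 assms(3,4)
      by (cases "D u = d"; force)+
    have "exp (- (real d * x)) + exp (- (real d * y)) = 1" if all: "\<forall>u\<in>A. D u = d"
    proof -
      have "- (real d * x) = - vloss d c d" "- (real d * y) = - nloss d c d"
        unfolding x y using all card by simp_all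
      then show ?thesis using exp_losses_diag[of c d] c2 assms(3) by simp
    qed
    then show ?thesis
      using exp_averages_le_one[of A "\<lambda>u. - vloss d c (D u)" "\<lambda>u. - nloss d c (D u)"]
        assms(1) False le eq unfolding x y by blast
  qed
  then show "exp (- (real d * x)) + exp (- (real d * y)) \<le> 1"
    and "exp (- (real d * x)) + exp (- (real d * y)) = 1 \<longleftrightarrow> (\<forall>u\<in>A. D u = d)" by blast+
qed

section \<open>Graphs without closed walks of length 5\<close>

text \<open>With a bare relation and a varying vertex set, deleting vertices is a set difference,
  and the double cover is another instance.\<close>

locale simple_adjacency =
  fixes R :: "'v \<Rightarrow> 'v \<Rightarrow> bool"
  assumes sym: "R x y \<Longrightarrow> R y x"
    and irrefl: "\<not> R x x"
begin

section \<open>Induced subgraphs and the logarithm of the bound\<close>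

definition nbrs :: "'v set \<Rightarrow> 'v \<Rightarrow> 'v set" where
  "nbrs V v = {u \<in> V. R v u}"

definition dg :: "'v set \<Rightarrow> 'v \<Rightarrow> nat" where
  "dg V v = card (nbrs V v)"

definition adj_pairs :: "'v set \<Rightarrow> ('v \<times> 'v) set" where
  "adj_pairs V = {(x, y). x \<in> V \<and> y \<in> V \<and> R x y}"

definition isets :: "'v set \<Rightarrow> 'v set set" where
  "isets V = {S. S \<subseteq> V \<and> (\<forall>u\<in>S. \<forall>v\<in>S. \<not> R u v)}"

text \<open>\<open>adj_pairs\<close> contains each edge in both directions, whence the division by
  2.\<close>

definition pot :: "'v set \<Rightarrow> real" where
  "pot V = (\<Sum>v\<in>V. if dg V v = 0 then ln 2 else 0)
     + (\<Sum>(x, y)\<in>adj_pairs V. ef (dg V x) (dg V y)) / 2"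

text \<open>Describes disjoint unions of complete bipartite graphs and isolated vertices without
  mentioning components.\<close>

definition p4_closed :: "'v set \<Rightarrow> bool" where
  "p4_closed V \<longleftrightarrow> (\<forall>x\<in>V. \<forall>y\<in>V. \<forall>z\<in>V. \<forall>t\<in>V. R x y \<longrightarrow> R y z \<longrightarrow> R z t \<longrightarrow> R x t)"

text \<open>Vertices may repeat, so triangles are excluded along with 5-cycles.\<close>

definition no_closed_5_walk :: "'v set \<Rightarrow> bool" where
  "no_closed_5_walk V \<longleftrightarrow> (\<forall>a\<in>V. \<forall>b\<in>V. \<forall>c\<in>V. \<forall>d\<in>V. \<forall>e\<in>V.
     \<not> (R a b \<and> R b c \<and> R c d \<and> R d e \<and> R e a))"

lemma finite_nbrs [simp]: "finite V \<Longrightarrow> finite (nbrs V v)"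
  by (simp add: nbrs_def)

lemma finite_adj_pairs [simp]: "finite V \<Longrightarrow> finite (adj_pairs V)"
  by (rule finite_subset[of _ "V \<times> V"]) (auto simp: adj_pairs_def)

lemma finite_isets: "finite V \<Longrightarrow> finite (isets V)"
  by (rule finite_subset[of _ "Pow V"]) (auto simp: isets_def)

lemma dg_eq_0_iff: "finite V \<Longrightarrow> dg V v = 0 \<longleftrightarrow> (\<forall>u\<in>V. \<not> R v u)"
  by (auto simp: dg_def nbrs_def)

lemma dg_mono: "finite V \<Longrightarrow> V' \<subseteq> V \<Longrightarrow> dg V' v \<le> dg V v"
  unfolding dg_def by (rule card_mono) (auto simp: nbrs_def)

lemma p4_closed_mono: "p4_closed V \<Longrightarrow> V' \<subseteq> V \<Longrightarrow> p4_closed V'"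
  unfolding p4_closed_def by (meson subsetD)

lemma no_closed_5_walk_mono: "no_closed_5_walk V \<Longrightarrow> V' \<subseteq> V \<Longrightarrow> no_closed_5_walk V'"
  unfolding no_closed_5_walk_def by (meson subsetD)

text \<open>The condition shortens a closed walk of length 5 to one of length 3, and that to a
  loop.\<close>

lemma p4_closed_imp_no_closed_5_walk: "p4_closed V \<Longrightarrow> no_closed_5_walk V"
  unfolding p4_closed_def no_closed_5_walk_def using irrefl by meson

lemma no_triangle:
  assumes "no_closed_5_walk V" "a \<in> V" "b \<in> V" "c \<in> V" "R a b" "R b c"
  shows "\<not> R c a"
  using assms sym unfolding no_closed_5_walk_def by meson

section \<open>Effect of vertex deletions\<close>

lemma card_isets_rec:
  assumes "finite V" "w \<in> V"
  shows "card (isets V) = card (isets (V - {w})) + card (isets (V - insert w (nbrs V w)))"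
proof -
  let ?V' = "V - insert w (nbrs V w)"
  have "isets V = isets (V - {w}) \<union> insert w ` isets ?V'"
  proof (intro set_eqI iffI)
    fix S assume S: "S \<in> isets V"
    show "S \<in> isets (V - {w}) \<union> insert w ` isets ?V'"
    proof (cases "w \<in> S")
      case True
      then have "S - {w} \<in> isets ?V'" using S by (auto simp: isets_def nbrs_def)
      moreover have "S = insert w (S - {w})" using True by auto
      ultimately show ?thesis by blast
    next
      case False
      then show ?thesis using S by (auto simp: isets_def)
    qed
  next
    fix S assume "S \<in> isets (V - {w}) \<union> insert w ` isets ?V'"
    then show "S \<in> isets V"
      using assms(2) irrefl sym unfolding isets_def nbrs_def by auto
  qed
  moreover have "isets (V - {w}) \<inter> insert w ` isets ?V' = {}" by (auto simp: isets_def)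
  moreover have "inj_on (insert w) (isets ?V')"
    by (rule inj_onI) (auto simp: isets_def insert_ident)
  ultimately show ?thesis
    using assms by (simp add: card_Un_disjoint finite_isets card_image)
qed

text \<open>Edges meeting \<open>X\<close> disappear, and among the surviving vertices only the
  boundary \<open>B\<close> changes degree. As \<open>B\<close> is independent, a surviving edge is
  affected at one end at most; a vertex of \<open>B\<close> left isolated gains
  \<open>ln 2\<close>.\<close>

lemma pot_diff:
  assumes fin: "finite V" and X: "X \<subseteq> V"
    and noniso: "\<And>x. x \<in> X \<Longrightarrow> dg V x \<noteq> 0"
  defines "B \<equiv> {b \<in> V - X. \<exists>x\<in>X. R x b}"
  assumes indep: "\<And>b b'. b \<in> B \<Longrightarrow> b' \<in> B \<Longrightarrow> \<not> R b b'"
  shows "pot V - pot (V - X) =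
    (\<Sum>(x, y)\<in>{(x, y) \<in> adj_pairs V. x \<in> X \<or> y \<in> X}. ef (dg V x) (dg V y)) / 2
    + (\<Sum>b\<in>B. (\<Sum>y\<in>nbrs (V - X) b. ef (dg V b) (dg V y) - ef (dg (V - X) b) (dg V y))
        - (if dg (V - X) b = 0 then ln 2 else 0))"
proof -
  define V' where "V' = V - X"
  define T where "T = {(x, y) \<in> adj_pairs V. x \<in> X \<or> y \<in> X}"
  define F where "F = (\<lambda>(x, y). ef (dg V x) (dg V y))"
  define F' where "F' = (\<lambda>(x, y). ef (dg V' x) (dg V' y))"
  define i where "i U v = (if dg U v = 0 then ln 2 else 0 :: real)" for U v
  have B: "B \<subseteq> V'" "finite B" and finV': "finite V'"
    using fin by (auto simp: B_def V'_def)
  have same: "dg V' y = dg V y" if "y \<in> V'" "y \<notin> B" for y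
  proof -
    have "nbrs V' y = nbrs V y"
      using that X sym by (auto simp: nbrs_def V'_def B_def)
    then show ?thesis by (simp add: dg_def)
  qed
  have isoB: "dg V b \<noteq> 0" if "b \<in> B" for b
    using that sym X fin by (auto simp: dg_eq_0_iff B_def)
  have "(\<Sum>v\<in>V. i V v) = (\<Sum>v\<in>V'. i V v)"
    using noniso fin by (intro sum.mono_neutral_right) (auto simp: V'_def i_def)
  moreover have "(\<Sum>v\<in>V'. i V v) - (\<Sum>v\<in>V'. i V' v) = (\<Sum>v\<in>B. i V v - i V' v)"
    unfolding sum_subtractf[symmetric] using B finV' same
    by (intro sum.mono_neutral_right) (auto simp: i_def)
  moreover have "(\<Sum>v\<in>B. i V v - i V' v) = - (\<Sum>b\<in>B. i V' b)"
    using isoB unfolding sum_negf[symmetric] by (intro sum.cong) (auto simp: i_def)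
  ultimately have iso: "(\<Sum>v\<in>V. i V v) - (\<Sum>v\<in>V'. i V' v) = - (\<Sum>b\<in>B. i V' b)" by linarith
  have "adj_pairs V = T \<union> adj_pairs V'" "T \<inter> adj_pairs V' = {}"
    by (auto simp: T_def V'_def adj_pairs_def)
  moreover have "finite T"
    by (rule finite_subset[OF _ finite_adj_pairs[OF fin]]) (auto simp: T_def)
  ultimately have "sum F (adj_pairs V) = sum F T + sum F (adj_pairs V')"
    using finV' by (simp add: sum.union_disjoint)
  moreover have "sum F (adj_pairs V') - sum F' (adj_pairs V')
      = 2 * (\<Sum>b\<in>B. \<Sum>y\<in>nbrs V' b. ef (dg V b) (dg V y) - ef (dg V' b) (dg V y))"
  proof -
    \<comment> \<open>The affected edges, directed away from \<open>B\<close>; with the reversed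
      pairs they give a factor 2 that cancels the halving in \<open>pot\<close>.\<close>
    let ?P = "Sigma B (nbrs V')"
    have P: "prod.swap ` ?P \<union> ?P \<subseteq> adj_pairs V'" "prod.swap ` ?P \<inter> ?P = {}"
      using B indep sym by (auto simp: adj_pairs_def nbrs_def)
    have zero: "F p - F' p = 0" if "p \<in> adj_pairs V' - (prod.swap ` ?P \<union> ?P)" for p
    proof -
      obtain x y where p: "p = (x, y)" by fastforce
      have "(x, y) \<in> prod.swap ` ?P" if "y \<in> B" "x \<in> V'" "R y x"
        using that by (auto simp: nbrs_def image_iff)
      then have "x \<notin> B" "y \<notin> B" "x \<in> V'" "y \<in> V'"
        using that sym p by (auto simp: adj_pairs_def nbrs_def)
      then show ?thesis using same by (simp add: p F_def F'_def)
    qed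
    have "sum F (adj_pairs V') - sum F' (adj_pairs V')
        = (\<Sum>p\<in>prod.swap ` ?P \<union> ?P. F p - F' p)"
      unfolding sum_subtractf[symmetric] using P zero finV'
      by (intro sum.mono_neutral_right) auto
    also have "\<dots> = (\<Sum>p\<in>prod.swap ` ?P. F p - F' p) + (\<Sum>p\<in>?P. F p - F' p)"
      using P B finV' by (intro sum.union_disjoint) auto
    also have "(\<Sum>p\<in>prod.swap ` ?P. F p - F' p) = (\<Sum>p\<in>?P. F p - F' p)"
      by (subst sum.reindex) (auto simp: F_def F'_def ef_commute intro!: sum.cong)
    also have "(\<Sum>p\<in>?P. F p - F' p)
        = (\<Sum>b\<in>B. \<Sum>y\<in>nbrs V' b. F (b, y) - F' (b, y))"
      using B finV' by (simp add: sum.Sigma)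
    also have "\<dots> = (\<Sum>b\<in>B. \<Sum>y\<in>nbrs V' b. ef (dg V b) (dg V y) - ef (dg V' b) (dg V y))"
    proof (intro sum.cong refl)
      fix b y assume b: "b \<in> B" and "y \<in> nbrs V' b"
      then have "y \<in> V'" "y \<notin> B" using indep by (auto simp: nbrs_def)
      then show "F (b, y) - F' (b, y) = ef (dg V b) (dg V y) - ef (dg V' b) (dg V y)"
        by (simp add: F_def F'_def same)
    qed
    finally show ?thesis by simp
  qed
  ultimately have "pot V - pot V' = sum F T / 2
    + (\<Sum>b\<in>B. \<Sum>y\<in>nbrs V' b. ef (dg V b) (dg V y) - ef (dg V' b) (dg V y)) - (\<Sum>b\<in>B. i V' b)"
    using iso unfolding pot_def F_def[symmetric] F'_def[symmetric] i_def[symmetric] by argo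
  then show ?thesis
    by (simp add: sum_subtractf F_def T_def V'_def i_def)
qed

text \<open>Allows each deleted edge to be counted once, directed away from
  \<open>w\<close>.\<close>

lemma sum_ef_swap:
  fixes h :: "'v \<Rightarrow> nat"
  assumes "finite P" "P \<inter> prod.swap ` P = {}"
  shows "(\<Sum>(x, y)\<in>P \<union> prod.swap ` P. ef (h x) (h y)) / 2 = (\<Sum>(x, y)\<in>P. ef (h x) (h y))"
proof -
  have "(\<Sum>(x, y)\<in>prod.swap ` P. ef (h x) (h y)) = (\<Sum>(x, y)\<in>P. ef (h x) (h y))"
    by (subst sum.reindex) (auto simp: ef_commute intro!: sum.cong)
  then show ?thesis using assms by (simp add: sum.union_disjoint)
qed

text \<open>\<open>star_losses\<close> handles each \<open>v\<close> in \<open>N\<close>; since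
  \<open>card N = d\<close>, averaging over \<open>N\<close> turns these bounds into one for the
  total. Equality makes every vertex of \<open>W\<close> a twin of \<open>w\<close>.\<close>

lemma pot_step:
  assumes fin: "finite V" and w: "w \<in> V"
    and max: "\<And>v. v \<in> V \<Longrightarrow> dg V v \<le> dg V w"
    and d5: "dg V w \<le> 5" and pos: "dg V w \<noteq> 0"
    and no5: "no_closed_5_walk V"
  defines "N \<equiv> nbrs V w"
  defines "W \<equiv> (\<Union>v\<in>N. nbrs V v) - {w}"
  shows "exp (pot (V - {w}) - pot V) + exp (pot (V - insert w N) - pot V) \<le> 1"
    and "exp (pot (V - {w}) - pot V) + exp (pot (V - insert w N) - pot V) = 1
      \<longleftrightarrow> (\<forall>u\<in>W. nbrs V u = N)"
proof -
  define d where "d = dg V w"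
  define A where "A v = nbrs V v - {w}" for v
  define V2 where "V2 = V - insert w N"
  define x where "x v = ef d (dg V v) + (\<Sum>u\<in>A v. ef (dg V v) (dg V u) - ef (dg V v - 1) (dg V u))
    - (if dg V v = 1 then ln 2 else 0)" for v
  \<comment> \<open>Each edge from \<open>v\<close> to \<open>u\<close> in \<open>W\<close> is
    credited with \<open>ln 2 / dg V u\<close> in place of the true effect of the deletion beyond
    \<open>u\<close>; \<open>s u\<close> below settles the difference.\<close>
  define y where "y v = ef d (dg V v) + (\<Sum>u\<in>A v. ef (dg V v) (dg V u) - ln 2 / real (dg V u))" for v
  define s where "s u = (\<Sum>z\<in>nbrs V2 u. ef (dg V u) (dg V z) - ef (dg V2 u) (dg V z))
    - (if dg V2 u = 0 then ln 2 else 0) + real (card (nbrs V u \<inter> N)) * (ln 2 / real (dg V u))" for u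
  have "real d > 0" using pos by (simp add: d_def)
  moreover have "card N = d" by (simp add: N_def d_def dg_def)
  moreover have "N \<subseteq> V" "w \<notin> N" using irrefl by (auto simp: N_def nbrs_def)
  ultimately have N: "N \<subseteq> V" "finite N" "w \<notin> N" "card N = d" "N \<noteq> {}" "real d > 0"
    using fin finite_subset by auto
  have adjN: "v \<in> N \<longleftrightarrow> v \<in> V \<and> R w v" for v by (auto simp: N_def nbrs_def)
  have W: "W \<subseteq> V" "finite W" "w \<notin> W"
    using fin N by (auto simp: W_def) (auto simp: nbrs_def)
  have memW: "u \<in> W \<longleftrightarrow> u \<in> V \<and> u \<noteq> w \<and> (\<exists>v\<in>N. R v u)" for u
    by (auto simp: W_def nbrs_def)
  have finA: "finite (A v)" for v using fin by (simp add: A_def)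
  have memA: "u \<in> A v \<longleftrightarrow> u \<in> W \<and> R v u" if "v \<in> N" for u v
    using that by (auto simp: A_def W_def nbrs_def)
  have indepN: "\<not> R v v'" if "v \<in> N" "v' \<in> N" for v v'
    using no_triangle[OF no5 w, of v v'] that sym by (auto simp: adjN)
  have WN: "u \<notin> N" if "u \<in> W" for u using that indepN by (auto simp: memW)
  \<comment> \<open>An edge inside \<open>W\<close> would close a walk of length 5 through
    \<open>w\<close>.\<close>
  have indepW: "\<not> R u u'" if "u \<in> W" "u' \<in> W" for u u'
  proof -
    obtain v v' where "v \<in> V" "R w v" "R v u" "v' \<in> V" "R w v'" "R v' u'" "u \<in> V" "u' \<in> V"
      using \<open>u \<in> W\<close> \<open>u' \<in> W\<close> by (auto simp: memW adjN)
    then show ?thesis using no5 w sym unfolding no_closed_5_walk_def by meson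
  qed
  have dg_pos: "dg V v \<ge> 1" if "R v z" "z \<in> V" for v z
    using that fin by (metis dg_eq_0_iff less_one not_le)

  have "{b \<in> V - {w}. \<exists>x\<in>{w}. R x b} = N" using irrefl by (auto simp: adjN)
  moreover have "{(x, y) \<in> adj_pairs V. x \<in> {w} \<or> y \<in> {w}} = {w} \<times> N \<union> prod.swap ` ({w} \<times> N)"
    using w sym by (auto simp: adj_pairs_def adjN)
  moreover have "{w} \<times> N \<inter> prod.swap ` ({w} \<times> N) = {}" using N by auto
  ultimately have "pot V - pot (V - {w}) = (\<Sum>(x, y)\<in>{w} \<times> N. ef (dg V x) (dg V y))
      + (\<Sum>v\<in>N. (\<Sum>u\<in>nbrs (V - {w}) v. ef (dg V v) (dg V u) - ef (dg (V - {w}) v) (dg V u))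
          - (if dg (V - {w}) v = 0 then ln 2 else 0))"
    using pot_diff[OF fin, of "{w}"] w pos indepN N by (simp add: sum_ef_swap)
  also have "(\<Sum>(x, y)\<in>{w} \<times> N. ef (dg V x) (dg V y)) = (\<Sum>v\<in>N. ef d (dg V v))"
    using N by (simp add: d_def flip: sum.cartesian_product)
  also have "(\<Sum>v\<in>N. (\<Sum>u\<in>nbrs (V - {w}) v. ef (dg V v) (dg V u) - ef (dg (V - {w}) v) (dg V u))
          - (if dg (V - {w}) v = 0 then ln 2 else 0)) = (\<Sum>v\<in>N. x v - ef d (dg V v))"
  proof (intro sum.cong refl)
    fix v assume v: "v \<in> N"
    have nb: "nbrs (V - {w}) v = A v" by (auto simp: nbrs_def A_def)
    have "w \<in> nbrs V v" using v sym[of w v] w by (auto simp: nbrs_def adjN)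
    then have "dg (V - {w}) v = dg V v - 1" "dg V v \<ge> 1"
      using fin card_gt_0_iff[of "nbrs V v"] by (auto simp: dg_def nb A_def Suc_le_eq)
    then show "(\<Sum>u\<in>nbrs (V - {w}) v. ef (dg V v) (dg V u) - ef (dg (V - {w}) v) (dg V u))
          - (if dg (V - {w}) v = 0 then ln 2 else 0) = x v - ef d (dg V v)"
      by (auto simp: nb x_def)
  qed
  finally have diff1: "pot V - pot (V - {w}) = (\<Sum>v\<in>N. x v)" by (simp add: sum_subtractf)

  \<comment> \<open>Second deletion, of \<open>insert w N\<close> with boundary \<open>W\<close>;
    \<open>?P\<close> directs the deleted edges away from \<open>w\<close>.\<close>
  let ?P = "{w} \<times> N \<union> Sigma N A"
  have B2: "{b \<in> V - insert w N. \<exists>x\<in>insert w N. R x b} = W"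
    using WN by (auto simp: memW) (auto simp: adjN)
  have swap: "(a, b) \<in> prod.swap ` S \<longleftrightarrow> (b, a) \<in> S" for a b :: 'v and S by force
  have P: "(a, b) \<in> ?P \<longleftrightarrow> a = w \<and> b \<in> N \<or> a \<in> N \<and> b \<in> V \<and> b \<noteq> w \<and> R a b" for a b
    by (auto simp: A_def nbrs_def)
  have "(a, b) \<in> {(x, y) \<in> adj_pairs V. x \<in> insert w N \<or> y \<in> insert w N}
      \<longleftrightarrow> (a, b) \<in> ?P \<union> prod.swap ` ?P" for a b
    unfolding Un_iff[of _ ?P] swap P using w sym[of a b] sym[of b a] by (auto simp: adj_pairs_def adjN)
  then have "{(x, y) \<in> adj_pairs V. x \<in> insert w N \<or> y \<in> insert w N} = ?P \<union> prod.swap ` ?P"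
    unfolding set_eq_iff split_paired_All by blast
  moreover have "?P \<inter> prod.swap ` ?P = {}"
    unfolding set_eq_iff split_paired_All Int_iff swap P using N(3) indepN by blast
  moreover have "finite ?P" using N finA by simp
  moreover have "dg V z \<noteq> 0" if "z \<in> insert w N" for z
    using that pos w sym fin by (auto simp: adjN dg_eq_0_iff)
  ultimately have "pot V - pot V2 = (\<Sum>(x, y)\<in>?P. ef (dg V x) (dg V y))
      + (\<Sum>u\<in>W. (\<Sum>z\<in>nbrs V2 u. ef (dg V u) (dg V z) - ef (dg V2 u) (dg V z))
          - (if dg V2 u = 0 then ln 2 else 0))"
    using pot_diff[OF fin, of "insert w N", unfolded B2] w indepW N
    by (simp add: sum_ef_swap V2_def)
  also have "(\<Sum>(x, y)\<in>?P. ef (dg V x) (dg V y))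
      = (\<Sum>(x, y)\<in>{w} \<times> N. ef (dg V x) (dg V y)) + (\<Sum>(x, y)\<in>Sigma N A. ef (dg V x) (dg V y))"
    using N finA by (intro sum.union_disjoint) auto
  also have "(\<Sum>(x, y)\<in>{w} \<times> N. ef (dg V x) (dg V y)) = (\<Sum>v\<in>N. ef d (dg V v))"
    using N by (simp add: d_def flip: sum.cartesian_product)
  also have "(\<Sum>(x, y)\<in>Sigma N A. ef (dg V x) (dg V y))
      = (\<Sum>v\<in>N. \<Sum>u\<in>A v. ef (dg V v) (dg V u))"
    using N finA by (simp add: sum.Sigma)
  also have "(\<Sum>v\<in>N. ef d (dg V v)) + (\<Sum>v\<in>N. \<Sum>u\<in>A v. ef (dg V v) (dg V u))
      = (\<Sum>v\<in>N. y v) + (\<Sum>v\<in>N. \<Sum>u\<in>A v. ln 2 / real (dg V u))"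
    by (simp add: y_def sum.distrib sum_subtractf)
  also have "(\<Sum>v\<in>N. \<Sum>u\<in>A v. ln 2 / real (dg V u))
      = (\<Sum>v\<in>N. \<Sum>u | u \<in> W \<and> R v u. ln 2 / real (dg V u))"
    using memA by (intro sum.cong) auto
  also have "\<dots> = (\<Sum>u\<in>W. \<Sum>v | v \<in> N \<and> R v u. ln 2 / real (dg V u))"
    by (rule sum.swap_restrict[OF N(2) W(2)])
  also have "\<dots> = (\<Sum>u\<in>W. real (card (nbrs V u \<inter> N)) * (ln 2 / real (dg V u)))"
  proof (intro sum.cong refl)
    fix u
    have "{v. v \<in> N \<and> R v u} = nbrs V u \<inter> N" using N sym by (auto simp: nbrs_def)
    then show "(\<Sum>v | v \<in> N \<and> R v u. ln 2 / real (dg V u))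
        = real (card (nbrs V u \<inter> N)) * (ln 2 / real (dg V u))" by simp
  qed
  finally have diff2: "pot V - pot V2 = (\<Sum>v\<in>N. y v) + (\<Sum>u\<in>W. s u)"
    by (simp add: s_def sum.distrib)

  \<comment> \<open>If \<open>u\<close> keeps no neighbour, its new \<open>ln 2\<close> equals the
    credits of its \<open>dg V u\<close> edges; otherwise \<open>ef_diff_less\<close> shows that the
    credits exceed the true gain.\<close>
  have s: "s u \<ge> 0" "s u = 0 \<longleftrightarrow> nbrs V u \<subseteq> N" if u: "u \<in> W" for u
  proof -
    have "\<not> R w u" using u W WN adjN by blast
    then have uw: "\<not> R u w" using sym by blast
    have nb: "nbrs V2 u = nbrs V u - N"
      using uw by (auto simp: V2_def nbrs_def)
    have "card (nbrs V u) = card (nbrs V u - N) + card (nbrs V u \<inter> N)"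
      using fin card_Int_Diff[of "nbrs V u" N] by simp
    then have D: "dg V u = dg V2 u + card (nbrs V u \<inter> N)" by (simp add: dg_def nb)
    obtain v where "v \<in> N" "R v u" using u by (auto simp: memW)
    then have "v \<in> nbrs V u \<inter> N" using N(1) sym[of v u] by (auto simp: nbrs_def)
    then have "card (nbrs V u \<inter> N) > 0" using N(2) by (auto simp: card_gt_0_iff)
    with D have less: "dg V2 u < dg V u" by simp
    have sub: "nbrs V u \<subseteq> N \<longleftrightarrow> dg V2 u = 0"
      using fin by (auto simp: dg_def nb)
    have "s u = 0" if k: "dg V2 u = 0"
    proof -
      have "nbrs V2 u = {}" "card (nbrs V u \<inter> N) = dg V u" using k sub nb D by auto
      then show ?thesis using k less by (simp add: s_def)
    qed
    moreover have "s u > 0" if k: "dg V2 u \<noteq> 0"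
    proof -
      have ne: "nbrs V2 u \<noteq> {}" "finite (nbrs V2 u)" using k fin by (auto simp: dg_def V2_def)
      have "(\<Sum>z\<in>nbrs V2 u. ln 2 / real (dg V u) - ln 2 / real (dg V2 u))
        < (\<Sum>z\<in>nbrs V2 u. ef (dg V u) (dg V z) - ef (dg V2 u) (dg V z))"
      proof (intro sum_strict_mono ne)
        fix z assume "z \<in> nbrs V2 u"
        then have "dg V z \<ge> 1" using dg_pos[of z u] sym[of u z] u W(1) by (auto simp: nbrs_def)
        then show "ln 2 / real (dg V u) - ln 2 / real (dg V2 u)
            < ef (dg V u) (dg V z) - ef (dg V2 u) (dg V z)"
          using ef_diff_less[of "dg V2 u" "dg V u" "dg V z"] k less by simp
      qed
      moreover have "(\<Sum>z\<in>nbrs V2 u. ln 2 / real (dg V u) - ln 2 / real (dg V2 u))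
          + real (card (nbrs V u \<inter> N)) * (ln 2 / real (dg V u)) = 0"
      proof -
        have k': "card (nbrs V2 u) = dg V2 u" by (simp add: dg_def)
        have m: "real (card (nbrs V u \<inter> N)) = real (dg V u) - real (dg V2 u)" using D by simp
        show ?thesis unfolding sum_constant k' m using k less by (simp add: field_simps)
      qed
      ultimately show ?thesis using k by (simp add: s_def)
    qed
    ultimately show "s u \<ge> 0" "s u = 0 \<longleftrightarrow> nbrs V u \<subseteq> N" using sub by fastforce+
  qed

  have star: "exp (- (real d * x v)) + exp (- (real d * y v)) \<le> 1"
    "exp (- (real d * x v)) + exp (- (real d * y v)) = 1 \<longleftrightarrow> (\<forall>u\<in>A v. dg V u = d)" if v: "v \<in> N" for v
  proof -
    have "w \<in> nbrs V v" using v sym[of w v] w by (auto simp: nbrs_def adjN)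
    then have "dg V v = Suc (card (A v))" using fin card.remove[of "nbrs V v" w] by (simp add: dg_def A_def)
    moreover have "dg V v \<le> d" "d \<le> 5" using v max d5 N by (auto simp: d_def)
    moreover have "1 \<le> dg V u \<and> dg V u \<le> d" if "u \<in> A v" for u
      using that v max sym[of v u] dg_pos[of u v] N(1) by (auto simp: d_def A_def nbrs_def)
    ultimately show "exp (- (real d * x v)) + exp (- (real d * y v)) \<le> 1"
      "exp (- (real d * x v)) + exp (- (real d * y v)) = 1 \<longleftrightarrow> (\<forall>u\<in>A v. dg V u = d)"
      unfolding x_def y_def
      using star_losses[of "A v" "dg V v" d "dg V"] finA by blast+
  qed
  have avg: "(\<Sum>v\<in>N. - (real d * h v)) / real (card N) = - sum h N" for h :: "'v \<Rightarrow> real"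
    using N by (simp add: sum_negf flip: sum_distrib_left)
  have le: "exp (- sum x N) + exp (- sum y N) \<le> 1"
    using exp_averages_le_one(1)[OF N(2,5) star(1)] unfolding avg .
  have eqD: "\<forall>u\<in>A v. dg V u = d" if "exp (- sum x N) + exp (- sum y N) = 1" "v \<in> N" for v
    using exp_averages_le_one(2)[OF N(2,5) star(1), unfolded avg, OF _ that(1) that(2)]
      star(2)[OF that(2)] by simp
  have s_nonneg: "sum s W \<ge> 0" using s by (intro sum_nonneg) auto
  have E: "exp (pot (V - {w}) - pot V) = exp (- sum x N)"
    "exp (pot (V - insert w N) - pot V) = exp (- sum y N - sum s W)"
    using diff1 diff2 by (simp_all add: V2_def algebra_simps)
  show "exp (pot (V - {w}) - pot V) + exp (pot (V - insert w N) - pot V) \<le> 1"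
    unfolding E using le s_nonneg
      exp_le_cancel_iff[of "- sum y N - sum s W" "- sum y N"] by linarith
  show "exp (pot (V - {w}) - pot V) + exp (pot (V - insert w N) - pot V) = 1
      \<longleftrightarrow> (\<forall>u\<in>W. nbrs V u = N)"
    unfolding E
  proof
    assume eq: "exp (- sum x N) + exp (- sum y N - sum s W) = 1"
    then have "exp (- sum y N) \<le> exp (- sum y N - sum s W)" using le by linarith
    then have "sum s W = 0" using s_nonneg by simp
    then have "s u = 0" if "u \<in> W" for u
      using that s W by (simp add: sum_nonneg_eq_0_iff)
    then have sub: "nbrs V u \<subseteq> N" if "u \<in> W" for u using that s by blast
    show "\<forall>u\<in>W. nbrs V u = N"
    proof
      fix u assume u: "u \<in> W"
      then obtain v where v: "v \<in> N" "u \<in> A v" using memA by (auto simp: memW)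
      have "exp (- sum x N) + exp (- sum y N) = 1" using eq \<open>sum s W = 0\<close> by simp
      then have "card (nbrs V u) = card N" using eqD v N by (auto simp: dg_def)
      then show "nbrs V u = N" using sub[OF u] N by (intro card_subset_eq) auto
    qed
  next
    assume all: "\<forall>u\<in>W. nbrs V u = N"
    then have "sum s W = 0" using s by (intro sum.neutral) auto
    \<comment> \<open>With twins throughout \<open>W\<close>, the sets \<open>N\<close> and
      \<open>W\<close> are completely joined and all \<open>v\<close> in \<open>N\<close> have equal
      shares, so averaging loses nothing.\<close>
    have AW: "A v = W" if v: "v \<in> N" for v
    proof -
      have "R v u" if "u \<in> W" for u
      proof -
        have "v \<in> nbrs V u" using all that v by blast
        then show ?thesis using sym by (simp add: nbrs_def)
      qed
      then show ?thesis using memA[OF v] by blast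
    qed
    have nbv: "nbrs V v = insert w W" if v: "v \<in> N" for v
    proof -
      have "w \<in> nbrs V v" using v sym[of w v] w by (auto simp: nbrs_def adjN)
      then show ?thesis using AW[OF v] by (auto simp: A_def)
    qed
    obtain v where v: "v \<in> N" using N by auto
    have "x v' = x v" "y v' = y v" if "v' \<in> N" for v'
      using that v by (simp_all add: x_def y_def dg_def nbv AW)
    then have "sum x N = real d * x v" "sum y N = real d * y v"
      using N by simp_all
    moreover have "\<forall>u\<in>A v. dg V u = d"
      using all N AW[OF v] by (simp add: dg_def)
    ultimately show "exp (- sum x N) + exp (- sum y N - sum s W) = 1"
      using star(2)[OF v] \<open>sum s W = 0\<close> by simp
  qed
qed

section \<open>Induction on the number of vertices\<close>

theorem card_isets_le_exp_pot_if_no_closed_5_walk: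
  assumes "finite V" "no_closed_5_walk V" "\<And>v. v \<in> V \<Longrightarrow> dg V v \<le> 5"
  shows "real (card (isets V)) \<le> exp (pot V)
    \<and> (real (card (isets V)) = exp (pot V) \<longleftrightarrow> p4_closed V)"
  using assms
proof (induction "card V" arbitrary: V rule: less_induct)
  case less
  note fin = less.prems(1)
  show ?case
  proof (cases "\<forall>v\<in>V. dg V v = 0")
    case True
    then have nonadj: "\<not> R u v" if "u \<in> V" "v \<in> V" for u v
      using that fin by (auto simp: dg_eq_0_iff)
    then have "isets V = Pow V" "adj_pairs V = {}" "p4_closed V"
      by (auto simp: isets_def adj_pairs_def p4_closed_def)
    moreover have "exp (pot V) = 2 ^ card V"
      using True \<open>adj_pairs V = {}\<close> by (simp add: pot_def exp_of_nat_mult)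
    ultimately show ?thesis using fin by (simp add: card_Pow)
  next
    case False
    have "V \<noteq> {}" using False by auto
    then obtain w where w: "w \<in> V" and "dg V w = Max (dg V ` V)"
      using fin Max_in[of "dg V ` V"] by fastforce
    then have max: "dg V v \<le> dg V w" if "v \<in> V" for v using that fin by simp
    with False have pos: "dg V w \<noteq> 0" by fastforce
    define N where "N = nbrs V w"
    define W where "W = (\<Union>v\<in>N. nbrs V v) - {w}"
    let ?V1 = "V - {w}" and ?V2 = "V - insert w N"
    have sub: "?V1 \<subseteq> V" "?V2 \<subseteq> V" by auto
    have IH: "real (card (isets U)) \<le> exp (pot U)
        \<and> (real (card (isets U)) = exp (pot U) \<longleftrightarrow> p4_closed U)" if "U \<subseteq> V" "w \<notin> U" for U
    proof (rule less.hyps)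
      show "card U < card V" using that w fin by (intro psubset_card_mono) auto
      show "finite U" using that fin finite_subset by blast
      show "no_closed_5_walk U" using that less.prems no_closed_5_walk_mono by blast
      show "dg U v \<le> 5" if "v \<in> U" for v
        using that \<open>U \<subseteq> V\<close> less.prems dg_mono[OF fin, of U v] by (meson order_trans subsetD)
    qed
    have rec: "real (card (isets V)) = real (card (isets ?V1)) + real (card (isets ?V2))"
      using card_isets_rec[OF fin w] by (simp add: N_def)
    have split: "exp (pot ?V1) + exp (pot ?V2)
        = exp (pot V) * (exp (pot ?V1 - pot V) + exp (pot ?V2 - pot V))"
      by (simp add: algebra_simps flip: exp_add)
    note step = pot_step[OF fin w max less.prems(3)[OF w] pos less.prems(2), folded N_def, folded W_def]
    have pot_le: "exp (pot ?V1) + exp (pot ?V2) \<le> exp (pot V)"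
      unfolding split using step(1) by (simp add: mult_le_cancel_left1)
    have pot_eq: "exp (pot ?V1) + exp (pot ?V2) = exp (pot V) \<longleftrightarrow> (\<forall>u\<in>W. nbrs V u = N)"
      unfolding split using step(2) by simp
    note IH1 = IH[of ?V1] and IH2 = IH[of ?V2]
    \<comment> \<open>The chain of estimates is tight exactly if both inductive bounds and the
      deletion step are.\<close>
    have "real (card (isets V)) = exp (pot V)
        \<longleftrightarrow> p4_closed ?V1 \<and> p4_closed ?V2 \<and> (\<forall>u\<in>W. nbrs V u = N)"
      using IH1 IH2 pot_le pot_eq rec sub by (smt (verit) Diff_iff insertCI)
    also have "\<dots> \<longleftrightarrow> p4_closed V"
    proof
      assume *: "p4_closed ?V1 \<and> p4_closed ?V2 \<and> (\<forall>u\<in>W. nbrs V u = N)"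
      \<comment> \<open>\<open>S\<close> and \<open>N\<close> are the sides of the complete
        bipartite component of \<open>w\<close>; \<open>?V2 - W\<close> is the rest of the
        graph.\<close>
      define S where "S = insert w W"
      have adj: "R a b \<longleftrightarrow> b \<in> N" if "a \<in> S" "b \<in> V" for a b
        using that * by (auto simp: S_def N_def nbrs_def)
      have SN: "b \<in> S" if "a \<in> N" "R a b" "b \<in> V" for a b
        using that by (auto simp: S_def W_def nbrs_def)
      have closed: "b \<in> ?V2 - W" if "a \<in> ?V2 - W" "R a b" "b \<in> V" for a b
      proof -
        have "a \<notin> S" "a \<notin> N" "a \<in> V" using that by (auto simp: S_def)
        then have "b \<notin> S" "b \<notin> N"
          using adj[of b a] SN[of b a] sym[OF that(2)] by blast+
        then show ?thesis using that(3) by (auto simp: S_def)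
      qed
      show "p4_closed V"
        unfolding p4_closed_def
      proof (intro ballI impI)
        fix x y z t
        assume V: "x \<in> V" "y \<in> V" "z \<in> V" "t \<in> V" and R: "R x y" "R y z" "R z t"
        consider "x \<in> S" | "x \<in> N" | "x \<in> ?V2 - W" using V by (auto simp: S_def)
        then show "R x t"
        proof cases
          case 1
          then have "y \<in> N" using adj V R by blast
          then have "z \<in> S" using SN V R by blast
          then show ?thesis using adj V R 1 by blast
        next
          case 2
          then have "y \<in> S" using SN V R by blast
          then have "z \<in> N" using adj V R by blast
          then have "t \<in> S" using SN V R by blast
          then show ?thesis using adj[of t x] V 2 sym by blast
        next
          case 3
          then have "y \<in> ?V2" "z \<in> ?V2" "t \<in> ?V2" using closed V R by blast+
          then show ?thesis using * 3 R unfolding p4_closed_def by blast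
        qed
      qed
    next
      assume good: "p4_closed V"
      have "nbrs V u = N" if u: "u \<in> W" for u
      proof -
        obtain v where v: "v \<in> V" "R w v" "R v u" "u \<in> V"
          using u by (auto simp: W_def N_def nbrs_def)
        \<comment> \<open>The path \<open>w\<close>, \<open>v\<close>, \<open>u\<close>, extended by
          \<open>z\<close> at either end, is shortcut by \<open>p4_closed\<close>.\<close>
        then have "R u z \<longleftrightarrow> R w z" if "z \<in> V" for z
          using that good w sym unfolding p4_closed_def by meson
        then show ?thesis by (auto simp: N_def nbrs_def)
      qed
      then show "p4_closed ?V1 \<and> p4_closed ?V2 \<and> (\<forall>u\<in>W. nbrs V u = N)"
        using p4_closed_mono[OF good] by auto
    qed
    finally show ?thesis using IH1 IH2 pot_le rec sub by auto
  qed
qed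

end

section \<open>The bipartite double cover\<close>

definition cover_adj :: "('v \<Rightarrow> 'v \<Rightarrow> bool) \<Rightarrow> 'v \<times> bool \<Rightarrow> 'v \<times> bool \<Rightarrow> bool" where
  "cover_adj R p q \<longleftrightarrow> R (fst p) (fst q) \<and> snd p \<noteq> snd q"

context simple_adjacency
begin

lemma simple_adjacency_cover: "simple_adjacency (cover_adj R)"
  by unfold_locales (auto simp: cover_adj_def sym)

text \<open>The Boolean alternates along a walk, so no closed walk has odd length.\<close>

lemma no_closed_5_walk_cover:
  "simple_adjacency.no_closed_5_walk (cover_adj R) (V \<times> UNIV)"
proof -
  interpret C: simple_adjacency "cover_adj R" by (rule simple_adjacency_cover)
  show ?thesis by (auto simp: C.no_closed_5_walk_def cover_adj_def)
qed

text \<open>A walk of length 3 lifts with alternating Booleans, and its ends lie on opposite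
  sides.\<close>

lemma p4_closed_if_cover:
  assumes "simple_adjacency.p4_closed (cover_adj R) (V \<times> UNIV)"
  shows "p4_closed V"
proof -
  interpret C: simple_adjacency "cover_adj R" by (rule simple_adjacency_cover)
  show ?thesis unfolding p4_closed_def
  proof (intro ballI impI)
    fix x y z t assume V: "x \<in> V" "y \<in> V" "z \<in> V" "t \<in> V" and R: "R x y" "R y z" "R z t"
    have "cover_adj R (x, False) (t, True)"
      using assms[unfolded C.p4_closed_def, rule_format,
          of "(x, False)" "(y, True)" "(z, False)" "(t, True)"] V R
      by (simp add: cover_adj_def)
    then show "R x t" by (simp add: cover_adj_def)
  qed
qed

lemma dg_cover: "simple_adjacency.dg (cover_adj R) (V \<times> UNIV) (x, i) = dg V x"
proof -
  interpret C: simple_adjacency "cover_adj R" by (rule simple_adjacency_cover)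
  have "C.nbrs (V \<times> UNIV) (x, i) = nbrs V x \<times> {\<not> i}"
    by (auto simp: C.nbrs_def nbrs_def cover_adj_def)
  then show ?thesis by (simp add: C.dg_def dg_def card_cartesian_product)
qed

text \<open>Each vertex and each ordered adjacent pair has two lifts, with the same degrees.\<close>

lemma pot_cover:
  assumes "finite V"
  shows "simple_adjacency.pot (cover_adj R) (V \<times> UNIV) = 2 * pot V"
proof -
  interpret C: simple_adjacency "cover_adj R" by (rule simple_adjacency_cover)
  let ?g = "\<lambda>((x, y), i). ((x, i), (y, \<not> i))"
  have "(\<Sum>p\<in>V \<times> UNIV. if C.dg (V \<times> UNIV) p = 0 then ln 2 else 0)
      = (\<Sum>p\<in>V \<times> (UNIV :: bool set). if dg V (fst p) = 0 then ln 2 else 0 :: real)"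
    by (intro sum.cong) (auto simp: dg_cover)
  also have "\<dots> = 2 * (\<Sum>v\<in>V. if dg V v = 0 then ln 2 else 0)"
    by (simp add: sum.cartesian_product' UNIV_bool sum_distrib_left)
  finally have iso: "(\<Sum>p\<in>V \<times> UNIV. if C.dg (V \<times> UNIV) p = 0 then ln 2 else 0)
      = 2 * (\<Sum>v\<in>V. if dg V v = 0 then ln 2 else 0 :: real)" .
  have pairs: "C.adj_pairs (V \<times> UNIV) = ?g ` (adj_pairs V \<times> UNIV)"
    by (force simp: C.adj_pairs_def adj_pairs_def cover_adj_def image_iff)
  have inj: "inj_on ?g (adj_pairs V \<times> UNIV)" by (auto simp: inj_on_def)
  have "(\<Sum>(p, q)\<in>C.adj_pairs (V \<times> UNIV). ef (C.dg (V \<times> UNIV) p) (C.dg (V \<times> UNIV) q))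
      = (\<Sum>e\<in>adj_pairs V \<times> (UNIV :: bool set). case fst e of (x, y) \<Rightarrow> ef (dg V x) (dg V y))"
    unfolding pairs by (subst sum.reindex[OF inj]) (auto simp: dg_cover intro!: sum.cong)
  also have "\<dots> = 2 * (\<Sum>(x, y)\<in>adj_pairs V. ef (dg V x) (dg V y))"
    by (simp add: sum.cartesian_product' UNIV_bool sum_distrib_left)
  finally show ?thesis using iso by (simp add: C.pot_def pot_def)
qed

text \<open>
  Two independent sets \<open>A\<close>, \<open>B\<close> induce a bipartite graph on \<open>A \<union> B\<close>. Exchanging \<open>A\<close> and \<open>B\<close> on one
  colour class of it, chosen depending on \<open>A \<union> B\<close> only, destroys the edges between \<open>A\<close> and \<open>B\<close>.
\<close>

lemma card_isets_square_le_cover: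
  assumes "finite V"
  shows "(card (isets V))\<^sup>2 \<le> card (simple_adjacency.isets (cover_adj R) (V \<times> UNIV))"
proof -
  interpret C: simple_adjacency "cover_adj R" by (rule simple_adjacency_cover)
  define col where "col U T \<longleftrightarrow> (\<forall>x\<in>U. \<forall>y\<in>U. R x y \<longrightarrow> (x \<in> T \<longleftrightarrow> y \<notin> T))" for U T :: "'v set"
  \<comment> \<open>For independent \<open>A\<close> and \<open>B\<close> the set \<open>A\<close>
    itself is such a class of \<open>A \<union> B\<close>, so the choice succeeds.\<close>
  define t where "t U = (SOME T. col U T)" for U
  define L where "L A B = (A - t (A \<union> B)) \<union> (B \<inter> t (A \<union> B))" for A B
  define f where "f = (\<lambda>(A, B). L A B \<times> {False} \<union> L B A \<times> {True})"
  have col_t: "col (A \<union> B) (t (A \<union> B))" if "A \<in> isets V" "B \<in> isets V" for A B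
  proof -
    have "col (A \<union> B) A" using that sym by (auto simp: col_def isets_def)
    then show ?thesis unfolding t_def by (rule someI)
  qed
  have LU: "L A B \<union> L B A = A \<union> B" for A B by (auto simp: L_def Un_commute)
  \<comment> \<open>The exchange preserves the union, hence the chosen class, and so undoes itself;
    injectivity follows.\<close>
  have inv: "L (L A B) (L B A) = A" for A B
    unfolding L_def[of "L A B"] LU by (auto simp: L_def Un_commute)
  have "inj f"
  proof (rule injI)
    fix p q assume eq: "f p = f q"
    obtain A B A' B' where p: "p = (A, B)" "q = (A', B')" by fastforce
    have f: "L A B = {x. (x, False) \<in> f (A, B)}" "L B A = {x. (x, True) \<in> f (A, B)}" for A B
      by (auto simp: f_def)
    have "L A B = L A' B'" "L B A = L B' A'"
      using eq unfolding p f(1)[of A B] f(1)[of A' B'] f(2)[of B A] f(2)[of B' A'] by simp_all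
    then show "p = q" using inv p by metis
  qed
  have "f p \<in> C.isets (V \<times> UNIV)" if "p \<in> isets V \<times> isets V" for p
  proof -
    from that obtain A B where p: "p = (A, B)" "A \<in> isets V" "B \<in> isets V" by auto
    have nonadj: "\<not> R x y" if "x \<in> L A B" "y \<in> L B A" for x y
    proof
      assume xy: "R x y"
      have "x \<in> A \<union> B" "y \<in> A \<union> B" using that by (auto simp: L_def)
      then have "x \<in> t (A \<union> B) \<longleftrightarrow> y \<notin> t (A \<union> B)"
        using col_t[OF p(2,3)] xy unfolding col_def by blast
      \<comment> \<open>Exactly one of \<open>x\<close> and \<open>y\<close> was exchanged, so both
        come from the same original set.\<close>
      then have "x \<in> A \<and> y \<in> A \<or> x \<in> B \<and> y \<in> B"
        using that by (auto simp: L_def Un_commute)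
      then show False using xy p by (auto simp: isets_def)
    qed
    moreover have "\<not> R y x" if "x \<in> L A B" "y \<in> L B A" for x y
      using nonadj[OF that] sym by blast
    moreover have "L A B \<subseteq> V" "L B A \<subseteq> V" using p by (auto simp: L_def isets_def)
    ultimately show ?thesis
      by (auto simp: C.isets_def p f_def cover_adj_def)
  qed
  then have "f ` (isets V \<times> isets V) \<subseteq> C.isets (V \<times> UNIV)" by blast
  moreover have "finite (C.isets (V \<times> UNIV))"
    using assms by (intro C.finite_isets) simp
  ultimately have "card (isets V \<times> isets V) \<le> card (C.isets (V \<times> UNIV))"
    using \<open>inj f\<close> by (metis card_inj_on_le inj_on_subset subset_UNIV)
  then show ?thesis by (simp add: card_cartesian_product power2_eq_square)
qed

text \<open>The squared count is at most the count for the cover, hence at most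
  \<open>exp (pot V) ^ 2\<close>; equality thus passes to the cover, whose structure descends to
  \<open>V\<close>. The converse is direct, as \<open>p4_closed\<close> excludes closed walks of
  length 5.\<close>

theorem card_isets_le_exp_pot:
  assumes fin: "finite V" and deg: "\<And>v. v \<in> V \<Longrightarrow> dg V v \<le> 5"
  shows "real (card (isets V)) \<le> exp (pot V)"
    and "real (card (isets V)) = exp (pot V) \<longleftrightarrow> p4_closed V"
proof -
  interpret C: simple_adjacency "cover_adj R" by (rule simple_adjacency_cover)
  have cover: "real (card (C.isets (V \<times> UNIV))) \<le> exp (pot V) ^ 2"
    "real (card (C.isets (V \<times> UNIV))) = exp (pot V) ^ 2 \<longleftrightarrow> C.p4_closed (V \<times> UNIV)"
    using C.card_isets_le_exp_pot_if_no_closed_5_walk[of "V \<times> UNIV"] fin deg no_closed_5_walk_cover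
    by (auto simp: dg_cover pot_cover exp_double)
  have square: "real (card (isets V)) ^ 2 \<le> real (card (C.isets (V \<times> UNIV)))"
    using card_isets_square_le_cover[OF fin] by (metis of_nat_le_iff of_nat_power)
  show "real (card (isets V)) \<le> exp (pot V)"
    by (rule power2_le_imp_le[OF order_trans[OF square cover(1)]]) simp
  show "real (card (isets V)) = exp (pot V) \<longleftrightarrow> p4_closed V"
  proof
    assume eq: "real (card (isets V)) = exp (pot V)"
    have "C.p4_closed (V \<times> UNIV)"
      unfolding cover(2)[symmetric] using square[unfolded eq] cover(1) by (rule antisym[rotated])
    then show "p4_closed V" by (rule p4_closed_if_cover)
  next
    assume "p4_closed V"
    then show "real (card (isets V)) = exp (pot V)"
      using card_isets_le_exp_pot_if_no_closed_5_walk[of V] fin deg p4_closed_imp_no_closed_5_walk by blast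
  qed
qed

end

section \<open>Components and the edge product\<close>

context graph
begin

lemma simple_adjacency_dominates: "simple_adjacency (\<lambda>u v. u \<rightarrow>\<^bsub>G\<^esub> v)"
  using adj_not_same by unfold_locales (blast intro: graph_symmetric)+

lemma ind_eq_card_isets: "ind G = card (simple_adjacency.isets (\<lambda>u v. u \<rightarrow>\<^bsub>G\<^esub> v) (verts G))"
proof -
  interpret A: simple_adjacency "\<lambda>u v. u \<rightarrow>\<^bsub>G\<^esub> v" by (rule simple_adjacency_dominates)
  have "indep_set G S \<longleftrightarrow> S \<in> A.isets (verts G)" for S
    by (auto simp: indep_set_def A.isets_def) (metis A.irrefl)
  then show ?thesis by (simp add: ind_def)
qed

lemma dg_eq_degree: "simple_adjacency.dg (\<lambda>u v. u \<rightarrow>\<^bsub>G\<^esub> v) (verts G) v = degree G v"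
proof -
  interpret A: simple_adjacency "\<lambda>u v. u \<rightarrow>\<^bsub>G\<^esub> v" by (rule simple_adjacency_dominates)
  have "A.nbrs (verts G) v = {u. v \<rightarrow>\<^bsub>G\<^esub> u}" by (auto simp: A.nbrs_def adj_in_verts)
  then show ?thesis by (simp add: A.dg_def degree_eq_card_neighbours)
qed

lemma exp_pot_eq:
  "exp (simple_adjacency.pot (\<lambda>u v. u \<rightarrow>\<^bsub>G\<^esub> v) (verts G))
    = 2 ^ num_iso G * (\<Prod>e\<in>edges G. edge_factor G e)"
proof -
  interpret A: simple_adjacency "\<lambda>u v. u \<rightarrow>\<^bsub>G\<^esub> v" by (rule simple_adjacency_dominates)
  let ?P = "A.adj_pairs (verts G)" and ?d = "degree G" and ?e = "\<lambda>(u, v). {u, v}"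
  have edges: "edges G = ?e ` ?P"
    by (auto simp: edges_def A.adj_pairs_def adj_in_verts)
  have finP: "finite ?P" by simp
  have factor: "edge_factor G {u, v} = exp (ef (?d u) (?d v))" if "u \<rightarrow>\<^bsub>G\<^esub> v" for u v
    using that A.irrefl ef_base_pos[of "?d u" "?d v"]
    by (subst edge_factor_doubleton) (auto simp: powr_def ef_def)
  \<comment> \<open>Ordered pairs are grouped by their undirected edge, two to each.\<close>
  have "(\<Sum>(u, v)\<in>?P. ef (?d u) (?d v))
      = (\<Sum>e\<in>edges G. \<Sum>p\<in>{p \<in> ?P. ?e p = e}. case p of (u, v) \<Rightarrow> ef (?d u) (?d v))"
    unfolding edges by (rule sum.image_gen[OF finP])
  also have "\<dots> = (\<Sum>e\<in>edges G. 2 * ln (edge_factor G e))"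
  proof (intro sum.cong refl)
    fix e assume "e \<in> edges G"
    then obtain u v where e: "e = {u, v}" "u \<rightarrow>\<^bsub>G\<^esub> v" by (auto simp: edges_def)
    then have "{p \<in> ?P. ?e p = e} = {(u, v), (v, u)}" "u \<noteq> v"
      using A.irrefl A.sym by (auto simp: A.adj_pairs_def adj_in_verts doubleton_eq_iff)
    then show "(\<Sum>p\<in>{p \<in> ?P. ?e p = e}. case p of (u, v) \<Rightarrow> ef (?d u) (?d v)) = 2 * ln (edge_factor G e)"
      using e by (simp add: factor ef_commute)
  qed
  finally have "A.pot (verts G) = (\<Sum>v\<in>verts G. if ?d v = 0 then ln 2 else 0)
      + (\<Sum>e\<in>edges G. ln (edge_factor G e))"
    by (simp add: A.pot_def dg_eq_degree flip: sum_distrib_left)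
  moreover have "(\<Sum>v\<in>verts G. if ?d v = 0 then ln 2 else 0) = real (num_iso G) * ln (2 :: real)"
    by (simp add: num_iso_def sum.If_cases Int_def)
  moreover have "exp (\<Sum>e\<in>edges G. ln (edge_factor G e)) = (\<Prod>e\<in>edges G. edge_factor G e)"
  proof -
    have "finite (edges G)" using finP by (simp add: edges)
    moreover have "exp (ln (edge_factor G e)) = edge_factor G e" if "e \<in> edges G" for e
      using that by (auto simp: edges_def factor)
    ultimately show ?thesis by (simp add: exp_sum)
  qed
  ultimately show ?thesis by (simp add: exp_add exp_of_nat_mult)
qed

section \<open>Connected components\<close>

lemma adj_component_iff:
  assumes "H \<in> components G"
  shows "u \<rightarrow>\<^bsub>H\<^esub> v \<longleftrightarrow> u \<in> verts H \<and> v \<in> verts H \<and> u \<rightarrow>\<^bsub>G\<^esub> v"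
proof -
  have ind: "induced_subgraph H G" using assms by (rule in_sccs_imp_induced)
  then have c: "tail H = tail G" "head H = head G"
    by (auto simp: induced_subgraph_def subgraph_def compatible_def)
  have "arcs H = {e \<in> arcs G. tail G e \<in> verts H \<and> head G e \<in> verts H}"
    using ind by blast
  then show ?thesis by (auto simp: arcs_ends_conv c)
qed

lemma adj_closed_component:
  assumes H: "H \<in> components G" and u: "u \<in> verts H" and "u \<rightarrow>\<^bsub>G\<^esub> v"
  shows "v \<in> verts H"
proof -
  have "verts H \<in> sccs_verts" using H by (intro in_sccs_vertsI_sccs) auto
  moreover have "u \<rightarrow>\<^sup>* v" "v \<rightarrow>\<^sup>* u" using assms(3) graph_symmetric by auto
  ultimately show ?thesis using u unfolding sccs_verts_def by blast
qed

lemma p4_closed_iff_components: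
  "simple_adjacency.p4_closed (\<lambda>u v. u \<rightarrow>\<^bsub>G\<^esub> v) (verts G)
    \<longleftrightarrow> (\<forall>H\<in>components G. complete_bipartite H \<or> card (verts H) = 1)"
proof -
  interpret A: simple_adjacency "\<lambda>u v. u \<rightarrow>\<^bsub>G\<^esub> v" by (rule simple_adjacency_dominates)
  show ?thesis
  proof (intro iffI ballI disjCI)
    fix H assume good: "A.p4_closed (verts G)" and H: "H \<in> components G" and card: "card (verts H) \<noteq> 1"
    have p4: "x \<rightarrow>\<^bsub>G\<^esub> t" if "x \<rightarrow>\<^bsub>G\<^esub> y" "y \<rightarrow>\<^bsub>G\<^esub> z" "z \<rightarrow>\<^bsub>G\<^esub> t" for x y z t
      using that good adj_in_verts unfolding A.p4_closed_def by meson
    note adjH = adj_component_iff[OF H]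
    have ind: "induced_subgraph H G" using H by (rule in_sccs_imp_induced)
    have conn: "strongly_connected H" using H by blast
    have sub: "verts H \<subseteq> verts G" using ind by blast
    then have finH: "finite (verts H)" by (rule finite_subset) simp
    obtain u where u: "u \<in> verts H" using conn by (auto simp: strongly_connected_def)
    moreover have "verts H \<noteq> {u}" using card by auto
    ultimately obtain z where z: "z \<in> verts H" "z \<noteq> u" by auto
    have reach: "(u, x) \<in> (arcs_ends H)\<^sup>*" if "x \<in> verts H" for x
      using conn u that by (auto simp: strongly_connected_def intro: reachable_rtranclI)
    obtain v where "u \<rightarrow>\<^bsub>H\<^esub> v" using reach[OF z(1)] z(2) by (metis converse_rtranclE)
    then have uv: "u \<rightarrow>\<^bsub>G\<^esub> v" "v \<rightarrow>\<^bsub>G\<^esub> u" "v \<in> verts H" by (auto simp: adjH graph_symmetric)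
    \<comment> \<open>The neighbourhoods of the ends of one edge \<open>uv\<close> turn out to be
      the two sides of the component.\<close>
    define U where "U = {x. v \<rightarrow>\<^bsub>G\<^esub> x}"
    define V where "V = {y. u \<rightarrow>\<^bsub>G\<^esub> y}"
    have UV_adj: "x \<rightarrow>\<^bsub>G\<^esub> y" if "x \<in> U" "y \<in> V" for x y
      using that p4[of x v u y] uv(2) graph_symmetric[of v x] by (auto simp: U_def V_def)
    have U_nb: "y \<in> V" if "x \<in> U" "x \<rightarrow>\<^bsub>G\<^esub> y" for x y
      using that p4[OF uv(1)] by (auto simp: U_def V_def)
    have V_nb: "y \<in> U" if "x \<in> V" "x \<rightarrow>\<^bsub>G\<^esub> y" for x y
      using that p4[OF uv(2)] by (auto simp: U_def V_def)
    have "x \<in> U \<union> V" if "(u, x) \<in> (arcs_ends H)\<^sup>*" for x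
      using that
    proof induction
      case base
      show ?case using uv by (simp add: U_def)
    next
      case (step x y)
      then show ?case using U_nb V_nb adjH by blast
    qed
    then have "verts H \<subseteq> U \<union> V" using reach by blast
    moreover have "U \<subseteq> verts H" "V \<subseteq> verts H"
      using adj_closed_component[OF H] u uv by (auto simp: U_def V_def)
    ultimately have verts: "verts H = U \<union> V" by blast
    have disj: "U \<inter> V = {}" using UV_adj A.irrefl by blast
    have "arcs_ends H = U \<times> V \<union> V \<times> U"
    proof (intro set_eqI)
      fix p :: "'a \<times> 'a"
      obtain x y where p: "p = (x, y)" by fastforce
      show "p \<in> arcs_ends H \<longleftrightarrow> p \<in> U \<times> V \<union> V \<times> U"
        unfolding p adjH verts using UV_adj U_nb V_nb graph_symmetric by blast
    qed
    moreover have "graph H"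
    proof -
      interpret H: digraph H using ind by (rule digraphI_induced)
      show ?thesis using induced_graph_imp_symmetric[OF sym_arcs ind] by (rule H.graphI)
    qed
    ultimately have "complete_bipartite_digraph (card U) (card V) H"
      using verts disj unfolding complete_bipartite_digraph_def by blast
    moreover have "u \<in> U" "v \<in> V" using uv by (auto simp: U_def V_def)
    then have "card U \<ge> 1" "card V \<ge> 1"
      using finH verts by (auto simp: Suc_le_eq card_gt_0_iff)
    ultimately show "complete_bipartite H" unfolding complete_bipartite_def by blast
  next
    assume comp: "\<forall>H\<in>components G. complete_bipartite H \<or> card (verts H) = 1"
    show "A.p4_closed (verts G)"
      unfolding A.p4_closed_def
    proof (intro ballI impI)
      fix x y z t assume R: "x \<rightarrow>\<^bsub>G\<^esub> y" "y \<rightarrow>\<^bsub>G\<^esub> z" "z \<rightarrow>\<^bsub>G\<^esub> t"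
      define H where "H = G \<restriction> {v. x \<rightarrow>\<^sup>* v}"
      have x: "x \<in> verts G" using R adj_in_verts by blast
      then have H: "H \<in> components G" unfolding H_def by (rule induce_reachable_is_in_sccs)
      have xH: "x \<in> verts H" using x by (simp add: H_def)
      then have mem: "y \<in> verts H" "z \<in> verts H" "t \<in> verts H"
        using adj_closed_component[OF H] R by blast+
      have "x \<noteq> y" using R A.irrefl by blast
      then have "card (verts H) \<noteq> 1" using xH mem by (auto simp: card_1_singleton_iff)
      then have "complete_bipartite H" using comp H by blast
      then obtain U V where "U \<inter> V = {}" "arcs_ends H = U \<times> V \<union> V \<times> U"
        unfolding complete_bipartite_def complete_bipartite_digraph_def by auto
      moreover have "x \<rightarrow>\<^bsub>H\<^esub> y" "y \<rightarrow>\<^bsub>H\<^esub> z" "z \<rightarrow>\<^bsub>H\<^esub> t"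
        using R xH mem by (auto simp: adj_component_iff[OF H])
      ultimately have "x \<rightarrow>\<^bsub>H\<^esub> t" by blast
      then show "x \<rightarrow>\<^bsub>G\<^esub> t" by (simp add: adj_component_iff[OF H])
    qed
  qed
qed

end

theorem theorem3:
  fixes G :: "('a, 'b) pre_digraph"
  assumes "graph G"
    and "\<forall>v\<in>verts G. degree G v \<le> 5"
  shows "real (ind G) \<le> 2 ^ num_iso G * (\<Prod>e\<in>edges G. edge_factor G e) \<and>
    (real (ind G) = 2 ^ num_iso G * (\<Prod>e\<in>edges G. edge_factor G e) \<longleftrightarrow>
      (\<forall>H\<in>components G. complete_bipartite H \<or> card (verts H) = 1))"
proof -
  interpret graph G by fact
  interpret A: simple_adjacency "\<lambda>u v. u \<rightarrow>\<^bsub>G\<^esub> v" by (rule simple_adjacency_dominates)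
  have "A.dg (verts G) v \<le> 5" if "v \<in> verts G" for v
    using assms(2) that by (simp add: dg_eq_degree)
  then show ?thesis
    using A.card_isets_le_exp_pot[of "verts G"]
    by (simp add: ind_eq_card_isets exp_pot_eq p4_closed_iff_components)
qed

end
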